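(* Every linked partition ideal $\mathcal{C}\subseteq\mathsf{Par}$ is regularly linked.
   Context: A partition is a finite weakly decreasing sequence of positive integers (possibly empty); $\mathsf{Par}$ is the set of all partitions, identified with the set of finitely supported sequences $(f_i)_{i\ge1}$ of nonnegative integers via $f_i=m_i(\lambda)$ (the number of parts equal to $i$). $\emptyset_{\mathsf{Par}}$ is the empty partition. For $\mathcal{C}\subseteq\mathsf{Par}$ and $m>0$, $\mathcal{C}_{\le m}$ (resp. $\mathcal{C}_{>m}$) is the set of $\lambda\in\mathcal{C}$ all of whose parts are $\le m$ (resp. $>m$); in particular $\mathsf{Par}_{\le m}$ is defined. $\lambda\oplus\mu$ is the partition whose multiset of parts is the multiset union of those of $\lambda$ and $\mu$. $\phi_+((\lambda_1,\dots,\lambda_\ell))=(\lambda_1+1,\dots,\lambda_\ell+1)$. For a set $I$ and a map $\pi:I\to\mathsf{Par}_{\le m}$, $\mathsf{Seq}(I,\pi)$ is the set of infinite sequences $(i_1,i_2,\dots)$ in $I$ with $\pi(i_j)\ne\emptyset_{\mathsf{Par}}$ for only finitely many $j$, and $\pi^\bullet(i_1,i_2,i_3,\dots)=\pi(i_1)\oplus\phi_+^m(\pi(i_2))\oplus\phi_+^{2m}(\pi(i_3))\oplus\cdots\in\mathsf{Par}$. Partition ideal (PI): a subset $\mathcal{C}\subseteq\mathsf{Par}$ such that if $(f_i)_{i\ge1}\in\mathcal{C}$ and $(g_i)_{i\ge1}\in\mathsf{Par}$ satisfies $g_i\le f_i$ for all $i$, then $(g_i)_{i\ge1}\in\mathcal{C}$.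 A PI $\mathcal{C}$ has modulus $m>0$ if $\phi_+^m(\mathcal{C})=\mathcal{C}_{>m}$. Linked partition ideal: a subset $\mathcal{C}\subseteq\mathsf{Par}$ for which there exists an integer $m>0$ such that (L1) $\mathcal{C}$ is a PI having modulus $m$; (L2) $\mathcal{C}_{\le m}$ is finite; (L3) there exist maps $L:\mathcal{C}_{\le m}\to2^{\mathcal{C}_{\le m}}$ and $s:\mathcal{C}_{\le m}\to\mathbb{Z}_{>0}$ such that $\mathrm{id}_{\mathcal{C}_{\le m}}^\bullet(S)=\mathcal{C}$, where $S$ is the set of $(\lambda^{(i)})_{i\ge1}\in\mathsf{Seq}(\mathcal{C}_{\le m},\mathrm{id}_{\mathcal{C}_{\le m}})$ such that for all $j\ge1$: $\lambda^{(j+1)}=\cdots=\lambda^{(j+s(\lambda^{(j)})-1)}=\emptyset_{\mathsf{Par}}$ and $\lambda^{(j+s(\lambda^{(j)}))}\in L(\lambda^{(j)})$. (Here $\mathrm{id}_{\mathcal{C}_{\le m}}$ is viewed as the inclusion map $\mathcal{C}_{\le m}\to\mathsf{Par}_{\le m}$.) Regularly linked: for a finite nonempty set $I$, $I^+$ is the set of nonempty finite words over $I$; a language is regular if it is recognized by a deterministic finite automaton. An infinite sequence matches a word $j_1\cdots j_n$ ($n\ge1$) if the word occurs as a block of consecutive entries; it begins with the word if the word is its initial block. $\mathsf{avoid}(S,X,X')$ is the set of $\vec{i}\in S$ that match no word of $X$ and begin with no word of $X'$. A subset $\mathcal{C}\subseteq\mathsf{Par}$ is regularly linked if there exist an integer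 $m>0$, a nonempty finite set $I$, an injective map $\pi:I\to\mathsf{Par}_{\le m}$ and regular languages $X,X'\subseteq I^+$ such that $\pi^\bullet(\mathsf{avoid}(\mathsf{Seq}(I,\pi),X,X'))=\mathcal{C}$. *)

theory Defs
  imports "HOL-Library.Multiset" "HOL-Library.FuncSet"
begin

section \<open>Partitions\<close>

text \<open>A partition is the finite multiset of its (positive) parts, so that \<open>count \<mu> i\<close> is the
  multiplicity of \<open>i\<close>, \<open>{#}\<close> is the empty partition, and multiset sum is the union of the
  multisets of parts.\<close>

definition Par :: "nat multiset set" where
  "Par = {\<mu>. 0 \<notin># \<mu>}"

definition parts_le :: "nat \<Rightarrow> nat multiset set \<Rightarrow> nat multiset set" where
  "parts_le m C = {\<mu> \<in> C. \<forall>p \<in># \<mu>. p \<le> m}"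

definition parts_gt :: "nat \<Rightarrow> nat multiset set \<Rightarrow> nat multiset set" where
  "parts_gt m C = {\<mu> \<in> C. \<forall>p \<in># \<mu>. p > m}"

definition phi_plus :: "nat multiset \<Rightarrow> nat multiset" where
  "phi_plus \<mu> = image_mset Suc \<mu>"

section \<open>Sequences of partitions\<close>

text \<open>Infinite sequences are functions on \<^typ>\<open>nat\<close>, indexed from 0.\<close>

definition Seq :: "'i set \<Rightarrow> ('i \<Rightarrow> nat multiset) \<Rightarrow> (nat \<Rightarrow> 'i) set" where
  "Seq I \<pi> = {x. (\<forall>j. x j \<in> I) \<and> finite {j. \<pi> (x j) \<noteq> {#}}}"

text \<open>The sum is restricted to the finitely many nonempty terms, the finiteness being part of
  the definition of \<^const>\<open>Seq\<close>.\<close>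

definition bullet :: "nat \<Rightarrow> ('i \<Rightarrow> nat multiset) \<Rightarrow> (nat \<Rightarrow> 'i) \<Rightarrow> nat multiset" where
  "bullet m \<pi> x = (\<Sum>j \<in> {j. \<pi> (x j) \<noteq> {#}}. (phi_plus ^^ (j * m)) (\<pi> (x j)))"

section \<open>Linked partition ideals\<close>

definition partition_ideal :: "nat multiset set \<Rightarrow> bool" where
  "partition_ideal C \<longleftrightarrow> C \<subseteq> Par \<and>
     (\<forall>f \<in> C. \<forall>g \<in> Par. (\<forall>i \<ge> 1. count g i \<le> count f i) \<longrightarrow> g \<in> C)"

definition has_modulus :: "nat multiset set \<Rightarrow> nat \<Rightarrow> bool" where
  "has_modulus C m \<longleftrightarrow> m > 0 \<and> (phi_plus ^^ m) ` C = parts_gt m C"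

definition linked_seqs ::
  "nat multiset set \<Rightarrow> (nat multiset \<Rightarrow> nat multiset set) \<Rightarrow> (nat multiset \<Rightarrow> nat)
     \<Rightarrow> (nat \<Rightarrow> nat multiset) set" where
  "linked_seqs D L s = {x \<in> Seq D id. \<forall>j.
     (\<forall>k. 1 \<le> k \<and> k < s (x j) \<longrightarrow> x (j + k) = {#}) \<and> x (j + s (x j)) \<in> L (x j)}"

definition linked_partition_ideal :: "nat multiset set \<Rightarrow> bool" where
  "linked_partition_ideal C \<longleftrightarrow> C \<subseteq> Par \<and>
     (\<exists>m > 0. partition_ideal C \<and> has_modulus C m \<and> finite (parts_le m C) \<and>
        (\<exists>L \<in> parts_le m C \<rightarrow> Pow (parts_le m C). \<exists>s \<in> parts_le m C \<rightarrow> {0<..}.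
           bullet m id ` linked_seqs (parts_le m C) L s = C))"

section \<open>Regular languages\<close>

text \<open>A deterministic finite automaton over the alphabet \<open>A\<close> with state set \<open>Q\<close>, initial
  state \<open>q0\<close>, transition function \<open>\<delta>\<close> and accepting states \<open>F\<close>.\<close>

definition dfa :: "'i set \<Rightarrow> 'q set \<Rightarrow> 'q \<Rightarrow> ('q \<Rightarrow> 'i \<Rightarrow> 'q) \<Rightarrow> 'q set \<Rightarrow> bool" where
  "dfa A Q q0 \<delta> F \<longleftrightarrow> finite Q \<and> q0 \<in> Q \<and> \<delta> \<in> Q \<rightarrow> A \<rightarrow> Q \<and> F \<subseteq> Q"

definition dfa_language :: "'i set \<Rightarrow> 'q \<Rightarrow> ('q \<Rightarrow> 'i \<Rightarrow> 'q) \<Rightarrow> 'q set \<Rightarrow> 'i list set" where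
  "dfa_language A q0 \<delta> F = {w \<in> lists A. foldl \<delta> q0 w \<in> F}"

text \<open>States are natural numbers without loss of generality, every finite set being in
  bijection with a finite set of naturals.\<close>

definition regular_language :: "'i set \<Rightarrow> 'i list set \<Rightarrow> bool" where
  "regular_language A X \<longleftrightarrow>
     (\<exists>(Q :: nat set) q0 \<delta> F. dfa A Q q0 \<delta> F \<and> X = dfa_language A q0 \<delta> F)"

definition nonempty_words :: "'i set \<Rightarrow> 'i list set" where
  "nonempty_words A = lists A - {[]}"

section \<open>Regularly linked sets\<close>

definition matches :: "(nat \<Rightarrow> 'i) \<Rightarrow> 'i list \<Rightarrow> bool" where
  "matches x w \<longleftrightarrow> (\<exists>k. map x [k..<k + length w] = w)"

definition begins_with :: "(nat \<Rightarrow> 'i) \<Rightarrow> 'i list \<Rightarrow> bool" where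
  "begins_with x w \<longleftrightarrow> map x [0..<length w] = w"

definition avoid :: "(nat \<Rightarrow> 'i) set \<Rightarrow> 'i list set \<Rightarrow> 'i list set \<Rightarrow> (nat \<Rightarrow> 'i) set" where
  "avoid S X X' = {x \<in> S. (\<forall>w \<in> X. \<not> matches x w) \<and> (\<forall>w \<in> X'. \<not> begins_with x w)}"

text \<open>The finite index set \<open>I\<close> is likewise taken to consist of natural numbers; this is no
  restriction, since everything below is invariant under relabelling \<open>I\<close>.\<close>

definition regularly_linked :: "nat multiset set \<Rightarrow> bool" where
  "regularly_linked C \<longleftrightarrow> C \<subseteq> Par \<and>
     (\<exists>m > 0. \<exists>(I :: nat set) \<pi> X X'.
        finite I \<and> I \<noteq> {} \<and> \<pi> \<in> I \<rightarrow> parts_le m Par \<and> inj_on \<pi> I \<and>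
        X \<subseteq> nonempty_words I \<and> regular_language I X \<and>
        X' \<subseteq> nonempty_words I \<and> regular_language I X' \<and>
        bullet m \<pi> ` avoid (Seq I \<pi>) X X' = C)"

end

(* Condition (L3) relates an entry of the sequence only to entries at most max s places later, and
   imposes the same constraint at every position. A sequence is therefore linked iff it matches none
   of finitely many forbidden words, and finite languages are regular. No forbidden prefixes are
   needed. *)
theory Submission
  imports Defs
begin

section \<open>Finite languages are regular\<close>

text \<open>\<open>regular_language\<close> asks for states that are natural numbers. Numbering the
  states by an injection \<open>h\<close> and conjugating the transitions by it preserves every run,
  so automata with states of any type may be used below.\<close>

lemma regular_language_dfa_language:
  assumes "dfa A Q q0 \<delta> F"
  shows "regular_language A (dfa_language A q0 \<delta> F)"
proof -
  have finQ: "finite Q" and q0: "q0 \<in> Q" and \<delta>: "\<And>q a. q \<in> Q \<Longrightarrow> a \<in> A \<Longrightarrow> \<delta> q a \<in> Q"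
    and F: "F \<subseteq> Q"
    using assms by (auto simp: dfa_def Pi_iff)
  obtain h :: "_ \<Rightarrow> nat" where h: "inj_on h Q"
    using finite_imp_inj_to_nat_seg[OF finQ] by blast
  define \<delta>' where "\<delta>' n a = h (\<delta> (inv_into Q h n) a)" for n a
  have run: "foldl \<delta> q w \<in> Q \<and> foldl \<delta>' (h q) w = h (foldl \<delta> q w)"
    if "q \<in> Q" "w \<in> lists A" for q w
    using that by (induction w arbitrary: q) (auto simp: \<delta>'_def h \<delta>)
  have "dfa A (h ` Q) (h q0) \<delta>' (h ` F)"
    using finQ q0 F by (auto simp: dfa_def \<delta>'_def h \<delta>)
  moreover have "dfa_language A q0 \<delta> F = dfa_language A (h q0) \<delta>' (h ` F)"
  proof -
    have "foldl \<delta>' (h q0) w \<in> h ` F \<longleftrightarrow> foldl \<delta> q0 w \<in> F" if "w \<in> lists A" for w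
      using run[OF q0 that] F inj_on_image_mem_iff[OF h] by metis
    then show ?thesis by (auto simp: dfa_language_def)
  qed
  ultimately show ?thesis unfolding regular_language_def by blast
qed

lemma finite_imp_regular_language:
  assumes "finite A" "finite X" "X \<subseteq> lists A"
  shows "regular_language A X"
proof -
  obtain n where n: "\<And>w. w \<in> X \<Longrightarrow> length w < n"
    using finite_nat_set_iff_bounded[of "length ` X"] \<open>finite X\<close> by auto
  \<comment> \<open>The state is the word read so far, truncated to a length that no word of \<open>X\<close> has.\<close>
  define \<delta> where "\<delta> q a = take n (q @ [a])" for q :: "'a list" and a
  define Q where "Q = {q. set q \<subseteq> A \<and> length q \<le> n}"
  have run: "foldl \<delta> [] w = take n w" for w
    by (induction w rule: rev_induct) (auto simp: \<delta>_def min_def)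
  have "dfa A Q [] \<delta> X"
    using assms n finite_lists_length_le[OF \<open>finite A\<close>, of n]
    by (fastforce simp: dfa_def Q_def \<delta>_def dest: in_set_takeD)
  moreover have "dfa_language A [] \<delta> X = X"
  proof -
    \<comment> \<open>A word of length at least \<open>n\<close> is truncated to length exactly
      \<open>n\<close>, hence falls outside \<open>X\<close>; a shorter word is unchanged.\<close>
    have "take n w \<in> X \<longleftrightarrow> w \<in> X" for w
      using n[of w] n[of "take n w"] by (cases "length w < n") auto
    then show ?thesis using assms(3) by (auto simp: dfa_language_def run)
  qed
  ultimately show ?thesis using regular_language_dfa_language by metis
qed

section \<open>Sequences avoiding finitely many words\<close>

text \<open>This changes the alphabet from partitions to natural numbers: \<open>\<pi>\<close>
  enumerates \<open>D\<close>, and the forbidden words are pulled back letterwise. As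
  \<open>\<pi>\<close> is injective, the preimage is again finite, hence regular.\<close>

lemma regularly_linked_if_finite_avoid:
  assumes C: "C \<subseteq> Par" and "m > 0"
    and D: "finite D" "D \<noteq> {}" "D \<subseteq> parts_le m Par"
    and X: "finite X" "X \<subseteq> nonempty_words D"
    and C_eq: "bullet m id ` avoid (Seq D id) X {} = C"
  shows "regularly_linked C"
proof -
  obtain \<pi> where bij: "bij_betw \<pi> {0..<card D} D"
    using ex_bij_betw_nat_finite[OF D(1)] by blast
  define I where "I = {0..<card D}"
  have inj: "inj_on \<pi> I" and img: "\<pi> ` I = D"
    using bij by (auto simp: bij_betw_def I_def)
  define Y where "Y = map \<pi> -` X \<inter> lists I"
  have "finite Y" unfolding Y_def
    by (intro finite_vimage_IntI X inj_on_mapI inj_on_subset[OF inj]) auto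
  have Y: "Y \<subseteq> nonempty_words I"
    using X(2) by (auto simp: Y_def nonempty_words_def)
  have Seq_iff: "\<pi> \<circ> x \<in> Seq D id \<longleftrightarrow> x \<in> Seq I \<pi>" if "\<And>j. x j \<in> I" for x
    using that img by (auto simp: Seq_def)
  have avoid_iff: "\<pi> \<circ> x \<in> avoid (Seq D id) X {} \<longleftrightarrow> x \<in> avoid (Seq I \<pi>) Y {}"
    if x: "\<And>j. x j \<in> I" for x
  proof -
    have "(\<exists>v\<in>X. matches (\<pi> \<circ> x) v) \<longleftrightarrow> (\<exists>w\<in>Y. matches x w)"
    proof
      assume "\<exists>v\<in>X. matches (\<pi> \<circ> x) v"
      then obtain v k where "v \<in> X" "map (\<pi> \<circ> x) [k..<k + length v] = v"
        by (auto simp: matches_def)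
      \<comment> \<open>The preimage of \<open>v\<close> is read off \<open>x\<close> itself, at the
        place where \<open>v\<close> occurs.\<close>
      then have "map x [k..<k + length v] \<in> Y" "matches x (map x [k..<k + length v])"
        using x by (auto simp: Y_def matches_def)
      then show "\<exists>w\<in>Y. matches x w" by blast
    next
      assume "\<exists>w\<in>Y. matches x w"
      then obtain w k where "w \<in> Y" "map x [k..<k + length w] = w"
        by (auto simp: matches_def)
      then have "map \<pi> w \<in> X" "matches (\<pi> \<circ> x) (map \<pi> w)"
        by (auto simp: Y_def matches_def simp flip: map_map intro!: exI[of _ k])
      then show "\<exists>v\<in>X. matches (\<pi> \<circ> x) v" by blast
    qed
    then show ?thesis using Seq_iff[OF x] by (auto simp: avoid_def)
  qed
  have lift: "\<exists>x. (\<forall>j. x j \<in> I) \<and> y = \<pi> \<circ> x" if "y \<in> Seq D id" for y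
  proof -
    have "y j \<in> \<pi> ` I" for j
      using that img by (auto simp: Seq_def)
    then show ?thesis
      by (intro exI[of _ "inv_into I \<pi> \<circ> y"]) (auto simp: inv_into_into f_inv_into_f fun_eq_iff)
  qed
  have "avoid (Seq D id) X {} = (\<lambda>x. \<pi> \<circ> x) ` avoid (Seq I \<pi>) Y {}"
  proof (intro equalityI subsetI)
    fix y assume y: "y \<in> avoid (Seq D id) X {}"
    then obtain x where x: "\<And>j. x j \<in> I" "y = \<pi> \<circ> x"
      using lift by (auto simp: avoid_def)
    with y avoid_iff show "y \<in> (\<lambda>x. \<pi> \<circ> x) ` avoid (Seq I \<pi>) Y {}" by blast
  next
    fix y assume "y \<in> (\<lambda>x. \<pi> \<circ> x) ` avoid (Seq I \<pi>) Y {}"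
    then obtain x where x: "x \<in> avoid (Seq I \<pi>) Y {}" "y = \<pi> \<circ> x" by blast
    then have "\<And>j. x j \<in> I" by (auto simp: avoid_def Seq_def)
    with x avoid_iff show "y \<in> avoid (Seq D id) X {}" by blast
  qed
  \<comment> \<open>\<open>bullet m id\<close> at \<open>\<pi> \<circ> x\<close> and
    \<open>bullet m \<pi>\<close> at \<open>x\<close> unfold to the same sum.\<close>
  then have "bullet m \<pi> ` avoid (Seq I \<pi>) Y {} = C"
    using C_eq by (simp add: image_image bullet_def)
  moreover have "regular_language I Y" "regular_language I {}"
    using \<open>finite Y\<close> Y by (auto intro!: finite_imp_regular_language simp: I_def nonempty_words_def)
  moreover have "finite I" "I \<noteq> {}" "\<pi> \<in> I \<rightarrow> parts_le m Par"
    using D img by (auto simp: I_def)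
  ultimately show ?thesis
    unfolding regularly_linked_def using C \<open>m > 0\<close> inj Y
    by (intro conjI exI[of _ m] exI[of _ I] exI[of _ \<pi>] exI[of _ Y] exI[of _ "{}"]) auto
qed

section \<open>Linked sequences\<close>

text \<open>Such a word is a block of entries at positions \<open>j\<close> to \<open>j + k\<close>
  that witnesses a failure at \<open>j\<close>: a nonempty partition inside the gap, or a successor
  that is not allowed. Only its two ends are constrained; the letters between are arbitrary.\<close>

definition unlinked_words ::
  "nat multiset set \<Rightarrow> (nat multiset \<Rightarrow> nat multiset set) \<Rightarrow> (nat multiset \<Rightarrow> nat)
     \<Rightarrow> nat multiset list set" where
  "unlinked_words D L s = {w \<in> nonempty_words D. \<exists>k. length w = Suc k \<and>
     (1 \<le> k \<and> k < s (hd w) \<and> last w \<noteq> {#} \<or> k = s (hd w) \<and> last w \<notin> L (hd w))}"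

lemma unlinked_words_subset: "unlinked_words D L s \<subseteq> nonempty_words D"
  by (auto simp: unlinked_words_def)

text \<open>The offset \<open>k\<close> is at most \<open>s (hd w)\<close>, which is bounded over
  the finite alphabet, so the lengths are bounded.\<close>

lemma finite_unlinked_words:
  assumes "finite D"
  shows "finite (unlinked_words D L s)"
proof (rule finite_subset)
  have "s (hd w) \<le> Max (s ` D)" if "w \<in> nonempty_words D" for w
    using assms that by (cases w) (auto simp: nonempty_words_def)
  then show "unlinked_words D L s \<subseteq> {w. set w \<subseteq> D \<and> length w \<le> Suc (Max (s ` D))}"
    by (fastforce simp: unlinked_words_def nonempty_words_def)
  show "finite {w. set w \<subseteq> D \<and> length w \<le> Suc (Max (s ` D))}"
    by (rule finite_lists_length_le[OF assms])
qed

text \<open>A failure at position \<open>j\<close> with offset \<open>k\<close> is the same as an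
  occurrence at \<open>j\<close> of an unlinked word of length \<open>Suc k\<close>, and
  \<open>matches\<close> ranges over all positions just as the linking condition does.\<close>

lemma linked_seqs_eq_avoid: "linked_seqs D L s = avoid (Seq D id) (unlinked_words D L s) {}"
proof -
  have "(\<exists>w\<in>unlinked_words D L s. matches x w) \<longleftrightarrow>
      (\<exists>j k. 1 \<le> k \<and> k < s (x j) \<and> x (j + k) \<noteq> {#} \<or> k = s (x j) \<and> x (j + k) \<notin> L (x j))"
    (is "?l \<longleftrightarrow> ?r") if x: "x \<in> Seq D id" for x
  proof -
    have hd_last: "hd (map x [j..<j + Suc k]) = x j" "last (map x [j..<j + Suc k]) = x (j + k)"
      for j k by (simp_all add: hd_map last_map del: upt_Suc)
    show ?thesis
    proof
      assume ?l
      then obtain w j k where w: "length w = Suc k" "map x [j..<j + length w] = w"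
        "1 \<le> k \<and> k < s (hd w) \<and> last w \<noteq> {#} \<or> k = s (hd w) \<and> last w \<notin> L (hd w)"
        unfolding unlinked_words_def matches_def by blast
      then have "hd w = x j" "last w = x (j + k)" using hd_last[of j k] by metis+
      with w(3) show ?r by metis
    next
      assume ?r
      then obtain j k where jk:
        "1 \<le> k \<and> k < s (x j) \<and> x (j + k) \<noteq> {#} \<or> k = s (x j) \<and> x (j + k) \<notin> L (x j)" by blast
      define w where "w = map x [j..<j + Suc k]"
      have "w \<in> nonempty_words D" using x by (auto simp: w_def nonempty_words_def Seq_def)
      moreover have "length w = Suc k" by (simp add: w_def)
      ultimately have "w \<in> unlinked_words D L s"
        using jk hd_last[of j k, folded w_def] by (auto simp: unlinked_words_def)
      moreover have "matches x w" by (auto simp: matches_def w_def intro!: exI[of _ j])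
      ultimately show ?l by blast
    qed
  qed
  then show ?thesis by (fastforce simp: linked_seqs_def avoid_def)
qed

theorem propositionE4:
  fixes C :: "nat multiset set"
  assumes "linked_partition_ideal C"
  shows "regularly_linked C"
proof -
  obtain m L s where C: "C \<subseteq> Par" and m: "m > 0" and fin: "finite (parts_le m C)"
    and C_eq: "bullet m id ` linked_seqs (parts_le m C) L s = C"
    using assms by (auto simp: linked_partition_ideal_def)
  have sub: "parts_le m C \<subseteq> parts_le m Par"
    using C by (auto simp: parts_le_def)
  show ?thesis
  proof (cases "parts_le m C = {}")
    case True
    \<comment> \<open>Here \<open>C\<close> is empty, but the index set must not be.\<close>
    then have "C = {}"
      using C_eq by (auto simp: linked_seqs_def Seq_def)
    \<comment> \<open>Over a one-letter alphabet the only sequence is constant, so forbidding that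
      letter as a word leaves nothing.\<close>
    moreover have "avoid (Seq {{#}} id) {[{#}]} {} = {}"
      by (auto simp: avoid_def Seq_def matches_def)
    ultimately show ?thesis
      using m by (intro regularly_linked_if_finite_avoid[of _ m "{{#}}" "{[{#}]}"])
        (auto simp: parts_le_def Par_def nonempty_words_def)
  next
    case False
    then show ?thesis
      using C m fin sub C_eq
      by (intro regularly_linked_if_finite_avoid[of _ m "parts_le m C"
          "unlinked_words (parts_le m C) L s"])
        (auto simp: finite_unlinked_words linked_seqs_eq_avoid intro: unlinked_words_subset[THEN subsetD])
  qed
qed

end
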